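(* Let $n \ge 1$ and let $x \in \Delta_n$. Then $$\mathcal{Q}_x = \mathcal{P}_x + \mathcal{N}_x + \mathcal{L}$$ (Minkowski sum). Furthermore, for any decomposition $Q = P + N + \lambda E$ of a matrix $Q \in \mathcal{Q}_x$ with $P \in \mathcal{P}_x$, $N \in \mathcal{N}_x$ and $\lambda \in \mathbb{R}$, we have $\lambda = x^T Q x = \ell(Q) = \nu(Q)$.
   Context: $\mathcal{S}^n$ is the space of real symmetric $n\times n$ matrices, with trace inner product $\langle U,V\rangle=\sum_{i,j}U_{ij}V_{ij}$; $e\in\mathbb{R}^n$ is the all-ones vector, $E=ee^T$; $\Delta_n=\{x\in\mathbb{R}^n: e^Tx=1,\ x\ge 0\}$. $\mathcal{PSD}^n$ is the cone of positive semidefinite matrices in $\mathcal{S}^n$, $\mathcal{N}^n$ the cone of entrywise nonnegative matrices in $\mathcal{S}^n$, and $\mathcal{DN}^n=\mathcal{PSD}^n\cap\mathcal{N}^n$. For $Q\in\mathcal{S}^n$: $\nu(Q)=\min\{x^TQx: x\in\Delta_n\}$, $\Omega(Q)=\{x\in\Delta_n: x^TQx=\nu(Q)\}$, and $\ell(Q)=\min\{\langle Q,X\rangle:\langle E,X\rangle=1,\ X\in\mathcal{DN}^n\}$ (the doubly nonnegative relaxation bound). For $x\in\Delta_n$: $\mathcal{Q}_x=\{Q\in\mathcal{S}^n: x\in\Omega(Q),\ \ell(Q)=\nu(Q)\}$; $\mathcal{P}_x=\{P\in\mathcal{PSD}^n: x^TPx=0\}$; $\mathcal{N}_x=\{N\in\mathcal{N}^n: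 x^TNx=0\}$. Also $\mathcal{L}=\{\lambda E:\lambda\in\mathbb{R}\}$. *)

theory Defs
  imports "HOL-Analysis.Analysis" "HOL-Library.Set_Algebras"
begin

text \<open>
  Matrices of order \<open>n\<close> have type \<^typ>\<open>real ^ 'n ^ 'n\<close> with \<open>n = CARD('n) \<ge> 1\<close>.
  On this type the library inner product \<open>U \<bullet> V\<close> is the trace inner product
  (lemma \<open>inner_matrix\<close> below), and \<open>+\<close> on sets of matrices is the Minkowski sum.
\<close>

definition sym_mats :: "(real ^ 'n ^ 'n) set" where
  "sym_mats = {Q. transpose Q = Q}"

definition ones :: "real ^ 'n" where
  "ones = (\<chi> i. 1)"

definition ones_mat :: "real ^ 'n ^ 'n" where
  "ones_mat = (\<chi> i j. ones $ i * ones $ j)"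

definition std_simplex :: "(real ^ 'n) set" where
  "std_simplex = {x. ones \<bullet> x = 1 \<and> (\<forall>i. 0 \<le> x $ i)}"

definition qform :: "real ^ 'n ^ 'n \<Rightarrow> real ^ 'n \<Rightarrow> real" where
  "qform Q x = x \<bullet> (Q *v x)"

definition psd_mats :: "(real ^ 'n ^ 'n) set" where
  "psd_mats = {P \<in> sym_mats. \<forall>y. 0 \<le> qform P y}"

definition nonneg_mats :: "(real ^ 'n ^ 'n) set" where
  "nonneg_mats = {N \<in> sym_mats. \<forall>i j. 0 \<le> N $ i $ j}"

definition dn_mats :: "(real ^ 'n ^ 'n) set" where
  "dn_mats = psd_mats \<inter> nonneg_mats"

definition dn_feasible :: "(real ^ 'n ^ 'n) set" where
  "dn_feasible = {X \<in> dn_mats. ones_mat \<bullet> X = 1}"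

text \<open>
  The two minima are written as infima; both are attained (lemmas \<open>nu_attained\<close> and
  \<open>ell_attained\<close> below), because the feasible sets are compact and nonempty.
\<close>

definition nu :: "real ^ 'n ^ 'n \<Rightarrow> real" where
  "nu Q = (INF x\<in>std_simplex. qform Q x)"

definition Omega :: "real ^ 'n ^ 'n \<Rightarrow> (real ^ 'n) set" where
  "Omega Q = {x \<in> std_simplex. qform Q x = nu Q}"

definition ell :: "real ^ 'n ^ 'n \<Rightarrow> real" where
  "ell Q = (INF X\<in>dn_feasible. Q \<bullet> X)"

definition Q_set :: "real ^ 'n \<Rightarrow> (real ^ 'n ^ 'n) set" where
  "Q_set x = {Q \<in> sym_mats. x \<in> Omega Q \<and> ell Q = nu Q}"

definition P_set :: "real ^ 'n \<Rightarrow> (real ^ 'n ^ 'n) set" where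
  "P_set x = {P \<in> psd_mats. qform P x = 0}"

definition N_set :: "real ^ 'n \<Rightarrow> (real ^ 'n ^ 'n) set" where
  "N_set x = {N \<in> nonneg_mats. qform N x = 0}"

definition L_set :: "(real ^ 'n ^ 'n) set" where
  "L_set = {c *\<^sub>R ones_mat | c. True}"

lemma inner_matrix:
  fixes U V :: "real ^ 'n ^ 'n"
  shows "U \<bullet> V = (\<Sum>i\<in>UNIV. \<Sum>j\<in>UNIV. U $ i $ j * V $ i $ j)"
  by (simp add: inner_vec_def)

lemma ones_mat_nth [simp]: "ones_mat $ i $ j = 1"
  by (simp add: ones_mat_def ones_def)

lemma compact_std_simplex: "compact (std_simplex :: (real ^ 'n) set)"
proof -
  have "norm x \<le> 1" if "x \<in> std_simplex" for x :: "real ^ 'n"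
  proof -
    have "(\<Sum>i\<in>UNIV. \<bar>x $ i\<bar>) = 1"
      using that by (auto simp: std_simplex_def ones_def inner_vec_def)
    then show ?thesis using norm_le_l1_cart[of x] by simp
  qed
  then have "bounded (std_simplex :: (real ^ 'n) set)" by (auto simp: bounded_iff)
  moreover have "closed (std_simplex :: (real ^ 'n) set)"
    unfolding std_simplex_def by (intro closed_Collect_conj closed_Collect_eq closed_Collect_all
      closed_Collect_le continuous_intros)
  ultimately show ?thesis by (simp add: compact_eq_bounded_closed)
qed

lemma std_simplex_nonempty: "(std_simplex :: (real ^ 'n) set) \<noteq> {}"
proof -
  have "axis undefined 1 \<in> (std_simplex :: (real ^ 'n) set)"
    by (simp add: std_simplex_def ones_def inner_axis) (simp add: axis_def)
  then show ?thesis by blast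
qed

lemma compact_dn_feasible: "compact (dn_feasible :: (real ^ 'n ^ 'n) set)"
proof -
  have "norm X \<le> 1" if "X \<in> dn_feasible" for X :: "real ^ 'n ^ 'n"
  proof -
    have "norm X \<le> (\<Sum>i\<in>UNIV. norm (X $ i))" unfolding norm_vec_def by (rule L2_set_le_sum) simp
    also have "\<dots> \<le> (\<Sum>i\<in>UNIV. \<Sum>j\<in>UNIV. \<bar>X $ i $ j\<bar>)" by (intro sum_mono norm_le_l1_cart)
    also have "\<dots> = 1"
      using that by (auto simp: dn_feasible_def dn_mats_def nonneg_mats_def inner_matrix)
    finally show ?thesis .
  qed
  then have "bounded (dn_feasible :: (real ^ 'n ^ 'n) set)" by (auto simp: bounded_iff)
  moreover have "dn_feasible = {X :: real ^ 'n ^ 'n. (\<forall>i j. X $ j $ i = X $ i $ j)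
      \<and> (\<forall>y. 0 \<le> qform X y) \<and> (\<forall>i j. 0 \<le> X $ i $ j) \<and> ones_mat \<bullet> X = 1}"
    by (auto simp: dn_feasible_def dn_mats_def psd_mats_def nonneg_mats_def sym_mats_def
      transpose_def vec_eq_iff)
  moreover have "closed \<dots>"
    unfolding qform_def matrix_vector_mult_def
    by (intro closed_Collect_conj closed_Collect_eq closed_Collect_all
      closed_Collect_le continuous_intros)
  ultimately show ?thesis by (simp add: compact_eq_bounded_closed)
qed

lemma dn_feasible_nonempty: "(dn_feasible :: (real ^ 'n ^ 'n) set) \<noteq> {}"
proof -
  let ?c = "1 / (real CARD('n))\<^sup>2"
  let ?X = "?c *\<^sub>R ones_mat :: real ^ 'n ^ 'n"
  have "qform ?X y = ?c * (\<Sum>i\<in>UNIV. y $ i)\<^sup>2" for y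
    by (simp add: qform_def matrix_vector_mult_def inner_vec_def power2_eq_square
      sum_distrib_left sum_distrib_right ac_simps)
  then have "?X \<in> dn_feasible"
    by (simp add: dn_feasible_def dn_mats_def psd_mats_def nonneg_mats_def sym_mats_def
      transpose_def vec_eq_iff inner_matrix power2_eq_square)
  then show ?thesis by blast
qed

lemma INF_attained:
  fixes f :: "'a::topological_space \<Rightarrow> real"
  assumes "compact S" "S \<noteq> {}" "continuous_on S f"
  shows "\<exists>x\<in>S. f x = (INF y\<in>S. f y) \<and> (\<forall>y\<in>S. f x \<le> f y)"
proof -
  obtain x where "x \<in> S" "\<forall>y\<in>S. f x \<le> f y"
    using continuous_attains_inf[OF assms] by blast
  moreover from this have "(INF y\<in>S. f y) = f x" by (intro cInf_eq_minimum) auto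
  ultimately show ?thesis by auto
qed

lemma nu_attained:
  "\<exists>x\<in>std_simplex. qform Q x = nu Q \<and> (\<forall>y\<in>std_simplex. qform Q x \<le> qform Q y)"
  unfolding nu_def qform_def matrix_vector_mult_def
  by (intro INF_attained compact_std_simplex std_simplex_nonempty continuous_intros)

lemma ell_attained:
  "\<exists>X\<in>dn_feasible. Q \<bullet> X = ell Q \<and> (\<forall>Y\<in>dn_feasible. Q \<bullet> X \<le> Q \<bullet> Y)"
  unfolding ell_def
  by (intro INF_attained compact_dn_feasible dn_feasible_nonempty continuous_intros)

end

theory Submission
  imports Defs
begin

text \<open>
  The doubly nonnegative bound is a linear program over the cone \<^term>\<open>dn_mats\<close>, and the
  proposition is strong duality together with complementary slackness for that program.

  The dual cone of \<^term>\<open>dn_mats\<close> within the symmetric matrices is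
  \<^term>\<open>psd_mats + nonneg_mats\<close>. One inclusion says that two positive semidefinite matrices
  have nonnegative inner product (\<open>inner_psd_nonneg\<close>); the other is a separation argument
  (\<open>dual_dn_cone\<close>), which requires the sum of the two cones to be closed
  (\<open>closed_psd_plus_nonneg\<close>).

  If \<open>Q = P + N + \<lambda> E\<close> with \<open>P\<close> and \<open>N\<close> in the two cones, then \<open>Q \<bullet> X \<ge> \<lambda>\<close> for every
  feasible \<open>X\<close>, with equality at the rank-one point \<open>x x\<^sup>T\<close> when \<open>P\<close> and \<open>N\<close> vanish at \<open>x\<close>;
  since every \<open>y y\<^sup>T\<close> with \<open>y\<close> in the simplex is feasible, \<open>x\<close> solves both minimisation
  problems and both values are \<open>\<lambda>\<close>. Conversely, let the two values agree at \<open>\<lambda> = x\<^sup>T Q x\<close>. Then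
  \<open>Q - \<lambda> E\<close> is nonnegative on all doubly nonnegative matrices, because every nonzero one is a
  multiple of a feasible one; so it is \<open>P + N\<close> with \<open>P\<close>, \<open>N\<close> in the two cones. As
  \<open>x\<^sup>T (P + N) x = 0\<close> and both summands are nonnegative at \<open>x\<close>, both vanish at \<open>x\<close>.
\<close>

section \<open>Quadratic forms as inner products with rank-one matrices\<close>

definition outer :: "real ^ 'n \<Rightarrow> real ^ 'n \<Rightarrow> real ^ 'n ^ 'n" where
  "outer v w = (\<chi> i j. v $ i * w $ j)"

lemma outer_nth [simp]: "outer v w $ i $ j = v $ i * w $ j"
  by (simp add: outer_def)

lemma inner_outer: "U \<bullet> outer v w = v \<bullet> (U *v w)"
  by (simp add: inner_matrix inner_vec_def matrix_vector_mult_def sum_distrib_left ac_simps)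

lemma qform_eq_inner: "qform Q v = Q \<bullet> outer v v"
  by (simp add: qform_def inner_outer)

lemma qform_outer_self: "qform (outer v v) z = (v \<bullet> z)\<^sup>2"
proof -
  have "outer v v *v z = (v \<bullet> z) *\<^sub>R v"
    by (simp add: vec_eq_iff matrix_vector_mult_def inner_vec_def sum_distrib_left ac_simps)
  then show ?thesis
    by (simp add: qform_def power2_eq_square inner_commute)
qed

lemma sym_mats_iff: "Q \<in> sym_mats \<longleftrightarrow> (\<forall>i j. Q $ i $ j = Q $ j $ i)"
  by (auto simp: sym_mats_def transpose_def vec_eq_iff)

lemma outer_self_in_sym_mats: "outer v v \<in> sym_mats"
  by (simp add: sym_mats_iff)

lemma sym_mats_inner_commute:
  assumes "Q \<in> sym_mats"
  shows "v \<bullet> (Q *v w) = w \<bullet> (Q *v v)"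
proof -
  have "v \<bullet> (Q *v w) = (transpose Q *v v) \<bullet> w"
    unfolding transpose_matrix_vector dot_lmul_matrix ..
  with assms show ?thesis
    by (simp add: sym_mats_def inner_commute)
qed

lemma inner_transpose_of_sym:
  assumes "Z \<in> sym_mats"
  shows "transpose Y \<bullet> Z = Y \<bullet> Z"
proof -
  have "transpose Y \<bullet> Z = (\<Sum>i\<in>UNIV. \<Sum>j\<in>UNIV. Y $ j $ i * Z $ j $ i)"
    using assms by (simp add: inner_matrix transpose_def sym_mats_iff)
  also have "\<dots> = Y \<bullet> Z"
    unfolding inner_matrix by (rule sum.swap)
  finally show ?thesis .
qed

lemma qform_add_scaleR:
  assumes "Q \<in> sym_mats"
  shows "qform Q (u + t *\<^sub>R w) = qform Q u + 2 * t * (u \<bullet> (Q *v w)) + t\<^sup>2 * qform Q w"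
  unfolding qform_def matrix_vector_right_distrib matrix_vector_mult_scaleR inner_add_left
    inner_add_right inner_scaleR_left inner_scaleR_right
    sym_mats_inner_commute[OF assms, of w u]
  by (simp add: power2_eq_square distrib_left)

lemma inner_axis_mult: "axis i 1 \<bullet> (Q *v axis j 1) = Q $ i $ j" for Q :: "real ^ 'n ^ 'n"
  by (simp add: inner_axis' matrix_vector_mult_basis column_def)

lemma qform_axis: "qform Q (axis i 1) = Q $ i $ i"
  by (simp add: qform_def inner_axis_mult)

lemma inner_ones_mat_outer: "ones_mat \<bullet> outer v v = (ones \<bullet> v)\<^sup>2" for v :: "real ^ 'n"
proof -
  have "ones_mat = outer ones (ones :: real ^ 'n)"
    by (simp add: ones_mat_def outer_def)
  then show ?thesis
    using qform_outer_self[of ones v] by (simp add: qform_eq_inner)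
qed

section \<open>Positive semidefinite matrices\<close>

lemma psd_entry_bound:
  assumes "P \<in> psd_mats"
  shows "2 * \<bar>P $ i $ j\<bar> \<le> P $ i $ i + P $ j $ j"
proof -
  have sym: "P \<in> sym_mats" and nonneg: "\<And>y. 0 \<le> qform P y"
    using assms by (auto simp: psd_mats_def)
  have "0 \<le> P $ i $ i + 2 * t * P $ i $ j + t\<^sup>2 * P $ j $ j" for t
    using nonneg[of "axis i 1 + t *\<^sub>R axis j 1"]
    unfolding qform_add_scaleR[OF sym] qform_axis inner_axis_mult .
  from this[of 1] this[of "-1"] show ?thesis
    by (simp add: abs_if)
qed

text \<open>
  One step of Cholesky elimination: subtracting the rank-one matrix built from column \<open>k\<close>
  completes the square in the \<open>k\<close>-th coordinate, so what is left is the minimum of the form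
  along that coordinate direction, which is still nonnegative.
\<close>

lemma psd_schur_step:
  assumes X: "X \<in> psd_mats" and pos: "0 < X $ k $ k"
  defines "c \<equiv> X *v axis k 1"
  shows "X - (1 / X $ k $ k) *\<^sub>R outer c c \<in> psd_mats"
proof -
  have sym: "X \<in> sym_mats" and nonneg: "\<And>y. 0 \<le> qform X y"
    using X by (auto simp: psd_mats_def)
  have "0 \<le> qform (X - (1 / X $ k $ k) *\<^sub>R outer c c) z" for z
  proof -
    define t where "t = - (z \<bullet> c) / X $ k $ k"
    have "0 \<le> qform X (z + t *\<^sub>R axis k 1)"
      by (rule nonneg)
    also have "\<dots> = qform X z + 2 * t * (z \<bullet> c) + t\<^sup>2 * X $ k $ k"
      unfolding qform_add_scaleR[OF sym] qform_axis c_def ..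
    also have "\<dots> = qform X z - (1 / X $ k $ k) * (c \<bullet> z)\<^sup>2"
      using pos unfolding t_def by (simp add: inner_commute[of z c] field_simps power2_eq_square)
    also have "(c \<bullet> z)\<^sup>2 = outer c c \<bullet> outer z z"
      unfolding qform_outer_self[symmetric] qform_eq_inner ..
    also have "qform X z - (1 / X $ k $ k) * (outer c c \<bullet> outer z z)
        = qform (X - (1 / X $ k $ k) *\<^sub>R outer c c) z"
      unfolding qform_eq_inner inner_diff_left inner_scaleR_left ..
    finally show ?thesis .
  qed
  moreover have "X - (1 / X $ k $ k) *\<^sub>R outer c c \<in> sym_mats"
    using sym by (simp add: sym_mats_iff mult.commute)
  ultimately show ?thesis
    by (simp add: psd_mats_def)
qed

text \<open>
  Each elimination step splits off a multiple of \<open>c c\<^sup>T\<close>, whose inner product with \<open>P\<close> is a value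
  of the quadratic form of \<open>P\<close>, and clears a diagonal entry of \<open>X\<close> without creating a new one.
  When the diagonal is zero the whole matrix is zero.
\<close>

lemma inner_psd_nonneg:
  assumes P: "P \<in> psd_mats" and "X \<in> psd_mats"
  shows "0 \<le> P \<bullet> X"
  using \<open>X \<in> psd_mats\<close>
proof (induction "card {i. X $ i $ i \<noteq> 0}" arbitrary: X rule: less_induct)
  case less
  note X = \<open>X \<in> psd_mats\<close>
  have diag: "0 \<le> X $ i $ i" for i
    using X qform_axis[of X i] by (metis (no_types, lifting) mem_Collect_eq psd_mats_def)
  show ?case
  proof (cases "\<forall>i. X $ i $ i = 0")
    case True
    then have "X = 0"
      using psd_entry_bound[OF X] by (simp add: vec_eq_iff)
    then show ?thesis by simp
  next
    case False
    then obtain k where k: "X $ k $ k \<noteq> 0" by blast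
    with diag[of k] have pos: "0 < X $ k $ k" by simp
    define c where "c = X *v axis k 1"
    define S where "S = X - (1 / X $ k $ k) *\<^sub>R outer c c"
    have S: "S \<in> psd_mats"
      using psd_schur_step[OF X pos] by (simp add: S_def c_def)
    have c_nth: "c $ i = X $ i $ k" for i
      by (simp add: c_def matrix_vector_mult_basis column_def)
    have "S $ i $ i = 0" if "X $ i $ i = 0" for i
    proof -
      have "S $ i $ i \<le> X $ i $ i"
        using pos by (simp add: S_def)
      moreover have "0 \<le> S $ i $ i"
        using S qform_axis[of S i] by (metis (no_types, lifting) mem_Collect_eq psd_mats_def)
      ultimately show ?thesis
        using that by simp
    qed
    moreover have "S $ k $ k = 0"
      using k by (simp add: S_def c_nth)
    ultimately have "{i. S $ i $ i \<noteq> 0} \<subset> {i. X $ i $ i \<noteq> 0}"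
      using k by blast
    then have "card {i. S $ i $ i \<noteq> 0} < card {i. X $ i $ i \<noteq> 0}"
      by (simp add: psubset_card_mono)
    then have "0 \<le> P \<bullet> S"
      using less.hyps S by blast
    moreover have "P \<bullet> X = P \<bullet> S + qform P c / X $ k $ k"
      by (simp add: S_def inner_diff_right qform_eq_inner)
    moreover have "0 \<le> qform P c"
      using P by (simp add: psd_mats_def)
    ultimately show ?thesis
      using pos by simp
  qed
qed

lemma inner_nonneg_nonneg:
  assumes "N \<in> nonneg_mats" "X \<in> nonneg_mats"
  shows "0 \<le> N \<bullet> X"
  using assms by (auto simp: inner_matrix nonneg_mats_def intro!: sum_nonneg)

section \<open>The dual of the doubly nonnegative cone\<close>

lemma closed_psd_mats: "closed (psd_mats :: (real ^ 'n ^ 'n) set)"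
proof -
  have "psd_mats = {X :: real ^ 'n ^ 'n. (\<forall>i j. X $ i $ j = X $ j $ i) \<and> (\<forall>y. 0 \<le> qform X y)}"
    by (auto simp: psd_mats_def sym_mats_iff)
  moreover have "closed \<dots>"
    unfolding qform_eq_inner
    by (intro closed_Collect_conj closed_Collect_eq closed_Collect_all
        closed_Collect_le continuous_intros)
  ultimately show ?thesis by simp
qed

lemma closed_nonneg_mats: "closed (nonneg_mats :: (real ^ 'n ^ 'n) set)"
proof -
  have "nonneg_mats = {X :: real ^ 'n ^ 'n. (\<forall>i j. X $ i $ j = X $ j $ i) \<and> (\<forall>i j. 0 \<le> X $ i $ j)}"
    by (auto simp: nonneg_mats_def sym_mats_iff)
  moreover have "closed \<dots>"
    by (intro closed_Collect_conj closed_Collect_eq closed_Collect_all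
        closed_Collect_le continuous_intros)
  ultimately show ?thesis by simp
qed

text \<open>
  The diagonal of a semidefinite matrix controls all its entries, and adding an entrywise
  nonnegative matrix cannot cancel the diagonal. This is what makes the sum of the two cones
  closed.
\<close>

lemma norm_psd_le_norm_sum:
  fixes P N :: "real ^ 'n ^ 'n"
  assumes P: "P \<in> psd_mats" and N: "N \<in> nonneg_mats"
  shows "norm P \<le> (real CARD('n))\<^sup>2 * norm (P + N)"
proof -
  have diag: "P $ i $ i \<le> norm (P + N)" for i
  proof -
    have "0 \<le> N $ i $ i"
      using N by (simp add: nonneg_mats_def)
    then have "P $ i $ i \<le> \<bar>(P + N) $ i $ i\<bar>"
      by simp
    also have "\<dots> \<le> norm ((P + N) $ i)"
      by (rule component_le_norm_cart)
    also have "\<dots> \<le> norm (P + N)"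
      by (rule Finite_Cartesian_Product.norm_nth_le)
    finally show ?thesis .
  qed
  have entry: "\<bar>P $ i $ j\<bar> \<le> norm (P + N)" for i j
    using psd_entry_bound[OF P, of i j] diag[of i] diag[of j] by linarith
  have "norm P \<le> (\<Sum>i\<in>UNIV. norm (P $ i))"
    unfolding norm_vec_def by (rule L2_set_le_sum) simp
  also have "\<dots> \<le> (\<Sum>i\<in>UNIV. \<Sum>j\<in>UNIV. \<bar>P $ i $ j\<bar>)"
    by (intro sum_mono norm_le_l1_cart)
  also have "\<dots> \<le> (\<Sum>i\<in>(UNIV :: 'n set). \<Sum>j\<in>(UNIV :: 'n set). norm (P + N))"
    by (intro sum_mono entry)
  finally show ?thesis
    by (simp add: power2_eq_square)
qed

text \<open>
  Near any limit point, only a bounded piece of the semidefinite cone contributes to the sum,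
  and a compact set plus a closed set is closed.
\<close>

lemma closed_psd_plus_nonneg: "closed (psd_mats + nonneg_mats :: (real ^ 'n ^ 'n) set)"
proof -
  let ?K = "psd_mats + nonneg_mats :: (real ^ 'n ^ 'n) set"
  have "Z \<in> ?K" if Z: "Z \<in> closure ?K" for Z
  proof -
    define R where "R = (real CARD('n))\<^sup>2 * (norm Z + 1)"
    define B where "B = (\<Union>P\<in>psd_mats \<inter> cball 0 R. \<Union>N\<in>(nonneg_mats :: (real ^ 'n ^ 'n) set). {P + N})"
    have "compact (psd_mats \<inter> cball 0 R :: (real ^ 'n ^ 'n) set)"
      by (intro closed_Int_compact closed_psd_mats compact_cball)
    then have "closed B"
      unfolding B_def by (intro compact_closed_sums closed_nonneg_mats)
    have near: "ball Z 1 \<inter> ?K \<subseteq> B"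
    proof
      fix Y assume Y: "Y \<in> ball Z 1 \<inter> ?K"
      then obtain P N where PN: "P \<in> psd_mats" "N \<in> nonneg_mats" "Y = P + N"
        by (auto elim: set_plus_elim)
      have "norm (P + N) \<le> norm Z + 1"
        using Y PN norm_triangle_ineq2[of Y Z] by (simp add: dist_norm norm_minus_commute)
      then have "norm P \<le> R"
        using norm_psd_le_norm_sum[OF PN(1,2)] unfolding R_def
        by (meson mult_left_mono order_trans zero_le_power2)
      with PN show "Y \<in> B"
        unfolding B_def by auto
    qed
    have "Z \<in> closure (ball Z 1 \<inter> ?K)"
      using open_Int_closure_subset[of "ball Z 1" ?K] Z by auto
    also have "\<dots> \<subseteq> B"
      using near \<open>closed B\<close> by (rule closure_minimal)
    finally show ?thesis
      unfolding B_def by (auto intro: set_plus_intro)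
  qed
  then show ?thesis
    using closure_subset_eq by blast
qed

lemma psd_mats_add: "P \<in> psd_mats \<Longrightarrow> P' \<in> psd_mats \<Longrightarrow> P + P' \<in> psd_mats"
  by (simp add: psd_mats_def sym_mats_iff qform_eq_inner inner_add_left)

lemma psd_mats_scaleR: "P \<in> psd_mats \<Longrightarrow> 0 \<le> t \<Longrightarrow> t *\<^sub>R P \<in> psd_mats"
  by (simp add: psd_mats_def sym_mats_iff qform_eq_inner)

lemma nonneg_mats_add: "N \<in> nonneg_mats \<Longrightarrow> N' \<in> nonneg_mats \<Longrightarrow> N + N' \<in> nonneg_mats"
  by (simp add: nonneg_mats_def sym_mats_iff)

lemma nonneg_mats_scaleR: "N \<in> nonneg_mats \<Longrightarrow> 0 \<le> t \<Longrightarrow> t *\<^sub>R N \<in> nonneg_mats"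
  by (simp add: nonneg_mats_def sym_mats_iff)

lemma zero_in_psd_mats: "0 \<in> psd_mats"
  by (simp add: psd_mats_def sym_mats_iff qform_eq_inner)

lemma zero_in_nonneg_mats: "0 \<in> nonneg_mats"
  by (simp add: nonneg_mats_def sym_mats_iff)

lemma psd_plus_nonneg_scaleR:
  assumes "Z \<in> psd_mats + nonneg_mats" "0 \<le> t"
  shows "t *\<^sub>R Z \<in> psd_mats + nonneg_mats"
  using assms
  by (auto elim!: set_plus_elim simp: scaleR_add_right
      intro!: set_plus_intro psd_mats_scaleR nonneg_mats_scaleR)

lemma convex_psd_plus_nonneg: "convex (psd_mats + nonneg_mats)"
proof (intro convex_set_plus convexI)
qed (simp_all add: psd_mats_add psd_mats_scaleR nonneg_mats_add nonneg_mats_scaleR)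

text \<open>
  A separating functional \<open>Y\<close> that is nonnegative on the sum of the two cones becomes, after
  symmetrisation, doubly nonnegative: testing it on \<open>y y\<^sup>T\<close> shows that it is semidefinite, and
  testing it on \<open>e\<^sub>i e\<^sub>j\<^sup>T + e\<^sub>j e\<^sub>i\<^sup>T\<close> shows that its entries are nonnegative.
\<close>

lemma dual_dn_cone:
  fixes Q :: "real ^ 'n ^ 'n"
  assumes sym: "Q \<in> sym_mats" and dual: "\<And>X. X \<in> dn_mats \<Longrightarrow> 0 \<le> Q \<bullet> X"
  shows "Q \<in> psd_mats + nonneg_mats"
proof (rule ccontr)
  assume "Q \<notin> psd_mats + nonneg_mats"
  from separating_hyperplane_closed_point[OF convex_psd_plus_nonneg closed_psd_plus_nonneg this]
  obtain Y b where Yb: "Y \<bullet> Q < b" "\<And>Z. Z \<in> psd_mats + nonneg_mats \<Longrightarrow> b < Y \<bullet> Z"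
    by blast
  have "0 \<in> psd_mats + (nonneg_mats :: (real ^ 'n ^ 'n) set)"
    using set_plus_intro[OF zero_in_psd_mats zero_in_nonneg_mats] by simp
  with Yb(2)[of 0] have "b < 0"
    by simp
  have Y_nonneg: "0 \<le> Y \<bullet> Z" if "Z \<in> psd_mats + nonneg_mats" for Z
  proof (rule ccontr)
    \<comment> \<open>Otherwise scaling \<open>Z\<close> makes the value of the functional equal to \<open>b\<close>.\<close>
    assume neg: "\<not> 0 \<le> Y \<bullet> Z"
    then have "b < Y \<bullet> ((b / (Y \<bullet> Z)) *\<^sub>R Z)"
      using that \<open>b < 0\<close> by (intro Yb psd_plus_nonneg_scaleR) (auto simp: divide_nonpos_neg)
    with neg show False by simp
  qed
  define X where "X = Y + transpose Y"
  have X_inner: "X \<bullet> Z = 2 * (Y \<bullet> Z)" if "Z \<in> sym_mats" for Z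
    using inner_transpose_of_sym[OF that, of Y] by (simp add: X_def inner_add_left)
  have X_sym: "X \<in> sym_mats"
    by (simp add: X_def sym_mats_iff transpose_def)
  have "0 \<le> qform X y" for y
  proof -
    have "outer y y \<in> psd_mats"
      by (simp add: psd_mats_def outer_self_in_sym_mats qform_outer_self)
    then have "outer y y \<in> psd_mats + nonneg_mats"
      using set_plus_intro[OF _ zero_in_nonneg_mats] by fastforce
    then show ?thesis
      using Y_nonneg X_inner[OF outer_self_in_sym_mats] by (simp add: qform_eq_inner)
  qed
  then have "X \<in> psd_mats"
    by (simp add: psd_mats_def X_sym)
  moreover have "0 \<le> X $ i $ j" for i j
  proof -
    let ?Z = "outer (axis i 1) (axis j 1) + outer (axis j 1) (axis i 1) :: real ^ 'n ^ 'n"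
    have "?Z \<in> nonneg_mats"
      by (simp add: nonneg_mats_def sym_mats_iff axis_def)
    then have "?Z \<in> psd_mats + nonneg_mats"
      using set_plus_intro[OF zero_in_psd_mats, of ?Z nonneg_mats] by simp
    then have "0 \<le> Y \<bullet> ?Z"
      by (rule Y_nonneg)
    also have "\<dots> = X $ i $ j"
      unfolding inner_add_right inner_outer inner_axis_mult by (simp add: X_def transpose_def)
    finally show ?thesis .
  qed
  then have "X \<in> nonneg_mats"
    by (simp add: nonneg_mats_def X_sym)
  ultimately have "0 \<le> Q \<bullet> X"
    by (intro dual) (simp add: dn_mats_def)
  also have "\<dots> = 2 * (Y \<bullet> Q)"
    using X_inner[OF sym] by (simp add: inner_commute)
  finally show False
    using Yb(1) \<open>b < 0\<close> by simp
qed

section \<open>Exactness of the doubly nonnegative bound\<close>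

lemma outer_self_in_dn_feasible:
  assumes "y \<in> std_simplex"
  shows "outer y y \<in> dn_feasible"
  using assms by (simp add: dn_feasible_def dn_mats_def psd_mats_def nonneg_mats_def
      outer_self_in_sym_mats qform_outer_self inner_ones_mat_outer std_simplex_def)

lemma qform_ones_mat: "x \<in> std_simplex \<Longrightarrow> qform ones_mat x = 1"
  by (simp add: qform_eq_inner inner_ones_mat_outer std_simplex_def)

lemma qform_decomposition:
  assumes "x \<in> std_simplex" "P \<in> P_set x" "N \<in> N_set x"
  shows "qform (P + N + l *\<^sub>R ones_mat) x = l"
  using assms qform_ones_mat[OF assms(1)]
  by (simp add: P_set_def N_set_def qform_eq_inner inner_add_left)

text \<open>
  Weak duality: \<open>l\<close> bounds the relaxation from below, and the feasible rank-one point \<open>x x\<^sup>T\<close>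
  attains it.
\<close>

lemma decomposition_in_Q_set:
  assumes x: "x \<in> std_simplex" and P: "P \<in> P_set x" and N: "N \<in> N_set x"
  shows "P + N + l *\<^sub>R ones_mat \<in> Q_set x" (is "?Q \<in> _")
proof -
  have lower: "l \<le> ?Q \<bullet> X" if X: "X \<in> dn_feasible" for X
  proof -
    have "0 \<le> P \<bullet> X" "0 \<le> N \<bullet> X"
      using X P N by (auto simp: dn_feasible_def dn_mats_def P_set_def N_set_def
          intro: inner_psd_nonneg inner_nonneg_nonneg)
    then show ?thesis
      using X by (simp add: inner_add_left dn_feasible_def)
  qed
  have value_at_x: "qform ?Q x = l"
    using x P N by (rule qform_decomposition)
  have "ell ?Q = l"
    unfolding ell_def
  proof (rule cInf_eq_minimum)
    show "l \<in> (\<bullet>) ?Q ` dn_feasible"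
      using value_at_x outer_self_in_dn_feasible[OF x] unfolding qform_eq_inner
      by (metis imageI)
  qed (use lower in auto)
  moreover have "nu ?Q = l"
    unfolding nu_def
  proof (rule cInf_eq_minimum)
    show "l \<in> qform ?Q ` std_simplex"
      using value_at_x x by (metis imageI)
  qed (use lower outer_self_in_dn_feasible in \<open>auto simp: qform_eq_inner\<close>)
  moreover have "?Q \<in> sym_mats"
    using P N by (simp add: P_set_def N_set_def psd_mats_def nonneg_mats_def sym_mats_iff)
  ultimately show ?thesis
    using x value_at_x by (simp add: Q_set_def Omega_def)
qed

lemma ell_mult_le_inner:
  assumes X: "X \<in> dn_mats"
  shows "ell Q * (ones_mat \<bullet> X) \<le> Q \<bullet> X"
proof (cases "ones_mat \<bullet> X = 0")
  case True
  have nonneg: "\<And>i j. 0 \<le> X $ i $ j"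
    using X by (simp add: dn_mats_def nonneg_mats_def)
  with True have "X = 0"
    by (simp add: inner_matrix sum_nonneg_eq_0_iff sum_nonneg vec_eq_iff)
  then show ?thesis by simp
next
  case False
  have "ones_mat \<in> nonneg_mats"
    by (simp add: nonneg_mats_def sym_mats_iff)
  then have "0 \<le> ones_mat \<bullet> X"
    using X by (auto simp: dn_mats_def intro: inner_nonneg_nonneg)
  with False have pos: "0 < ones_mat \<bullet> X" by simp
  then have "(1 / (ones_mat \<bullet> X)) *\<^sub>R X \<in> dn_feasible"
    using X by (simp add: dn_feasible_def dn_mats_def psd_mats_scaleR nonneg_mats_scaleR)
  then have "ell Q \<le> Q \<bullet> ((1 / (ones_mat \<bullet> X)) *\<^sub>R X)"
    using ell_attained[of Q] by auto
  with pos show ?thesis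
    by (simp add: field_simps)
qed

text \<open>
  Strong duality, and complementary slackness: the two nonnegative summands add up to zero
  at \<open>x\<close>.
\<close>

lemma Q_set_has_decomposition:
  assumes x: "x \<in> std_simplex" and Q: "Q \<in> Q_set x"
  obtains P N where "P \<in> P_set x" "N \<in> N_set x" "Q = P + N + ell Q *\<^sub>R ones_mat"
proof -
  have Qx: "qform Q x = ell Q" and sym: "Q \<in> sym_mats"
    using Q by (auto simp: Q_set_def Omega_def)
  have "Q - ell Q *\<^sub>R ones_mat \<in> psd_mats + nonneg_mats"
  proof (rule dual_dn_cone)
    show "Q - ell Q *\<^sub>R ones_mat \<in> sym_mats"
      using sym by (simp add: sym_mats_iff)
  qed (simp add: inner_diff_left ell_mult_le_inner)
  then obtain P N where PN: "P \<in> psd_mats" "N \<in> nonneg_mats" "Q - ell Q *\<^sub>R ones_mat = P + N"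
    by (auto elim: set_plus_elim)
  then have Q_eq: "Q = P + N + ell Q *\<^sub>R ones_mat"
    by (simp add: algebra_simps)
  have "qform P x + qform N x = qform (Q - ell Q *\<^sub>R ones_mat) x"
    unfolding PN(3) by (simp add: qform_eq_inner inner_add_left)
  also have "\<dots> = 0"
    using Qx qform_ones_mat[OF x] by (simp add: qform_eq_inner inner_diff_left)
  finally have "qform P x + qform N x = 0" .
  moreover have "0 \<le> qform P x"
    using PN by (simp add: psd_mats_def)
  moreover have "0 \<le> qform N x"
    using PN(2) outer_self_in_dn_feasible[OF x] unfolding qform_eq_inner
    by (intro inner_nonneg_nonneg) (auto simp: dn_feasible_def dn_mats_def)
  ultimately have "P \<in> P_set x" "N \<in> N_set x"
    using PN by (auto simp: P_set_def N_set_def)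
  then show ?thesis
    using Q_eq that by blast
qed

theorem proposition3p1:
  fixes x :: "real ^ 'n"
  assumes "x \<in> std_simplex"
  shows "Q_set x = P_set x + N_set x + L_set \<and>
    (\<forall>Q \<in> Q_set x. \<forall>P \<in> P_set x. \<forall>N \<in> N_set x. \<forall>l :: real.
      Q = P + N + l *\<^sub>R ones_mat \<longrightarrow> l = qform Q x \<and> qform Q x = ell Q \<and> ell Q = nu Q)"
proof (intro conjI ballI allI impI)
  show "Q_set x = P_set x + N_set x + L_set"
  proof (intro equalityI subsetI)
    fix Q assume "Q \<in> Q_set x"
    with assms obtain P N where "P \<in> P_set x" "N \<in> N_set x" "Q = P + N + ell Q *\<^sub>R ones_mat"
      by (rule Q_set_has_decomposition)
    moreover have "ell Q *\<^sub>R ones_mat \<in> L_set"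
      by (auto simp: L_set_def)
    ultimately show "Q \<in> P_set x + N_set x + L_set"
      by (metis set_plus_intro)
  next
    fix Q assume "Q \<in> P_set x + N_set x + L_set"
    then show "Q \<in> Q_set x"
      by (auto elim!: set_plus_elim simp: L_set_def intro: decomposition_in_Q_set[OF assms])
  qed
next
  fix Q P N and l :: real
  assume "Q \<in> Q_set x" "P \<in> P_set x" "N \<in> N_set x" "Q = P + N + l *\<^sub>R ones_mat"
  then show "l = qform Q x" "qform Q x = ell Q" "ell Q = nu Q"
    using qform_decomposition[OF assms] by (auto simp: Q_set_def Omega_def)
qed

end
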